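(* Let $\phi^{\mathrm{NEC}}:\{0,1\}^{\mathbb Z^2}\to\{0,1\}$ be the North-East-Center majority rule, that is, $\phi^{\mathrm{NEC}}(x)=1$ if $x(o)+x((1,0))+x((0,1))\ge 2$ and $\phi^{\mathrm{NEC}}(x)=0$ otherwise, where $o=(0,0)$. Then $2.8\cdot 10^{-6}<p_{\mathrm c}(\phi^{\mathrm{NEC}})$.
   Context: Let $\phi:\{0,1\}^{\mathbb Z^d}\to\{0,1\}$ be a map depending on finitely many coordinates and monotone for the coordinate-wise order (here $d=2$). For $p\in[0,1]$ the perturbed cellular automaton $(x_t)_{t\ge 0}$ is defined as follows: $x_0$ is the configuration equal to $1$ everywhere and, for each $t\ge 0$ and $i\in\mathbb Z^d$, independently over all space-time points, $x_{t+1}(i)=\phi(x_t(\cdot+i))$ with probability $1-p$ and $x_{t+1}(i)=0$ with probability $p$. Here $x_t(\cdot+i)$ is the configuration $j\mapsto x_t(j+i)$. Writing $\mathbb P_p$ for the law of this process, the stability threshold is $$p_{\mathrm c}(\phi):=\sup\Big\{p\in[0,1]:\ \liminf_{t\to\infty}\mathbb P_p(x_t(o)=1)>0\Big\}.$$ *)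

theory Defs
  imports "HOL-Probability.Probability"
begin

type_synonym site = "int \<times> int"

text \<open>Configurations in \<open>{0,1}\<^sup>Z\<^sup>2\<close>, with \<open>True\<close> for 1 and \<open>False\<close> for 0; the order
  \<open>\<le>\<close> on this type is the coordinate-wise one, so monotonicity of a local rule is \<^const>\<open>mono\<close>.\<close>

type_synonym config = "site \<Rightarrow> bool"

definition depends_on_finitely_many :: "(config \<Rightarrow> bool) \<Rightarrow> bool" where
  "depends_on_finitely_many \<phi> \<longleftrightarrow>
     (\<exists>A. finite A \<and> (\<forall>x y. (\<forall>i\<in>A. x i = y i) \<longrightarrow> \<phi> x = \<phi> y))"

text \<open>The process is realised as a function of independent space-time errors: \<open>\<xi> (t, i)\<close> says
  that the update producing the state of site \<open>i\<close> at time \<open>t + 1\<close> fails and yields 0.\<close>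

definition noise :: "real \<Rightarrow> (nat \<times> site \<Rightarrow> bool) measure" where
  "noise p = (\<Pi>\<^sub>M s\<in>UNIV. measure_pmf (bernoulli_pmf p))"

primrec perturbed_ca :: "(config \<Rightarrow> bool) \<Rightarrow> (nat \<times> site \<Rightarrow> bool) \<Rightarrow> nat \<Rightarrow> config" where
  "perturbed_ca \<phi> \<xi> 0 = (\<lambda>i. True)"
| "perturbed_ca \<phi> \<xi> (Suc t) =
     (\<lambda>i. if \<xi> (t, i) then False else \<phi> (\<lambda>j. perturbed_ca \<phi> \<xi> t (j + i)))"

definition prob_one_at_origin :: "(config \<Rightarrow> bool) \<Rightarrow> real \<Rightarrow> nat \<Rightarrow> real" where
  "prob_one_at_origin \<phi> p t =
     measure (noise p) {\<xi> \<in> space (noise p). perturbed_ca \<phi> \<xi> t (0, 0)}"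

text \<open>The limit inferior is taken in \<^typ>\<open>ereal\<close>, as \<^const>\<open>liminf\<close> requires a complete lattice.\<close>

definition stability_threshold :: "(config \<Rightarrow> bool) \<Rightarrow> real" where
  "stability_threshold \<phi> =
     Sup {p \<in> {0..1}. liminf (\<lambda>t. ereal (prob_one_at_origin \<phi> p t)) > 0}"

definition nec_majority :: "config \<Rightarrow> bool" where
  "nec_majority x \<longleftrightarrow>
     (of_bool (x (0, 0)) + of_bool (x (1, 0)) + of_bool (x (0, 1)) :: nat) \<ge> 2"

lemma mono_nec_majority: "mono nec_majority"
  by (auto simp: mono_def nec_majority_def le_fun_def split: if_splits)

lemma depends_on_finitely_many_nec_majority: "depends_on_finitely_many nec_majority"
  unfolding depends_on_finitely_many_def nec_majority_def
  by (rule exI[of _ "{(0, 0), (1, 0), (0, 1)}"]) simp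

lemma prob_space_noise: "prob_space (noise p)"
  unfolding noise_def by (intro prob_space_PiM prob_space_measure_pmf)

text \<open>The event defining \<^const>\<open>prob_one_at_origin\<close> is measurable, so its \<^const>\<open>measure\<close> is not
  the default value 0.\<close>

lemma measurable_perturbed_ca:
  assumes "depends_on_finitely_many \<phi>"
  shows "{\<xi> \<in> space (noise p). perturbed_ca \<phi> \<xi> t i} \<in> sets (noise p)"
proof -
  obtain A where A: "finite A" "\<And>x y. (\<forall>i\<in>A. x i = y i) \<Longrightarrow> \<phi> x = \<phi> y"
    using assms unfolding depends_on_finitely_many_def by blast
  have expand: "\<phi> x \<longleftrightarrow> (\<exists>B\<in>{B \<in> Pow A. \<phi> (\<lambda>j. j \<in> B)}. \<forall>j\<in>A. x j \<longleftrightarrow> j \<in> B)" for x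
  proof
    assume "\<phi> x"
    moreover have "\<phi> x = \<phi> (\<lambda>j. j \<in> {j \<in> A. x j})"
      by (rule A(2)) auto
    ultimately show "\<exists>B\<in>{B \<in> Pow A. \<phi> (\<lambda>j. j \<in> B)}. \<forall>j\<in>A. x j \<longleftrightarrow> j \<in> B"
      by (intro bexI[of _ "{j \<in> A. x j}"]) auto
  next
    assume "\<exists>B\<in>{B \<in> Pow A. \<phi> (\<lambda>j. j \<in> B)}. \<forall>j\<in>A. x j \<longleftrightarrow> j \<in> B"
    then obtain B where "\<phi> (\<lambda>j. j \<in> B)" "\<forall>j\<in>A. x j = (j \<in> B)" by blast
    then show "\<phi> x" using A(2)[of x "\<lambda>j. j \<in> B"] by blast
  qed
  have "Measurable.pred (noise p) (\<lambda>\<xi>. perturbed_ca \<phi> \<xi> t i)"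
  proof (induction t arbitrary: i)
    case 0
    show ?case by simp
  next
    case (Suc t)
    have [measurable]: "Measurable.pred (noise p) (\<lambda>\<xi>. \<xi> (t, i))"
      unfolding noise_def by (rule measurable_compose[OF measurable_component_singleton]) auto
    have [measurable]: "Measurable.pred (noise p) (\<lambda>\<xi>. \<phi> (\<lambda>j. perturbed_ca \<phi> \<xi> t (j + i)))"
      using A(1) Suc.IH
      by (subst expand) (intro pred_intros_finite pred_intros_logic; simp)
    show ?case by simp
  qed
  then show ?thesis by (simp add: pred_def)
qed

end

theory Submission
  imports Defs
begin

text \<open>A Peierls argument with explanation trees in the style of Gacs. A zero that is not an error
  has zeros in each of the three pairs \<open>A1\<close>, \<open>A2\<close>, \<open>A3\<close> of its three predecessors. Follow three
  poles \<open>u\<close>, \<open>v\<close>, \<open>w\<close> backwards in time, moving them inside \<open>A1\<close>, \<open>A2\<close>, \<open>A3\<close> respectively: the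
  spread \<open>w\<^sub>1 + w\<^sub>2 - u\<^sub>1 - v\<^sub>2\<close> grows by 1 in each step, whereas at an error all poles coincide and
  the spread is 0. Connected components of zeros (connected through neighbours and through their
  predecessors) are cut at errors into pieces with disjoint pasts, and gluing two pieces along a
  pair of neighbours pays for at most one unit of spread. Hence a zero at the origin comes with
  \<open>n\<close> distinct errors, organised in a binary tree with \<open>n - 1\<close> gluings and fewer than \<open>n\<close> backward
  steps. With at most \<open>8\<close> choices per step and \<open>18\<close> per gluing, the generating function \<open>C\<close> of the
  trees satisfies \<open>C = 1 + 8 y C + 18 x C\<^sup>2\<close>, which is bounded by 3 for \<open>y = 1/24\<close>, \<open>x = 1/162\<close>. This
  handles the error probability \<open>x y = 1/3888\<close>.\<close>

declare split_paired_Ex [simp del] split_paired_All [simp del]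

section \<open>Codes of explanation trees\<close>

datatype code =
    Leaf
  | Down site site site code
  | Join nat site code code

text \<open>The first coordinate is 0 on \<open>A1\<close>, the second is 0 on \<open>A2\<close>,
  and their sum is 1 on \<open>A3\<close>. Each pair omits one of the three predecessor
  offsets.\<close>

definition A1 :: "site set" where "A1 = {(0, 0), (0, 1)}"
definition A2 :: "site set" where "A2 = {(0, 0), (1, 0)}"
definition A3 :: "site set" where "A3 = {(1, 0), (0, 1)}"

text \<open>These are the differences of two distinct predecessor offsets among (0,0), (1,0), (0,1).
  Both coordinates and their sum are at most 1 on them.\<close>

definition forks :: "site set" where
  "forks = {(1, 0), (- 1, 0), (0, 1), (0, - 1), (1, - 1), (- 1, 1)}"

text \<open>A code, read from its first pole \<open>u\<close> at level \<open>t\<close>, determines the other two poles and the set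
  of errors. In \<open>Join k d c c'\<close> the \<open>k\<close>-th pole of \<open>c\<close> is glued along \<open>d\<close> to \<open>c'\<close>, whose \<open>k\<close>-th pole
  becomes the new one and whose other two poles both sit at the gluing point.\<close>

primrec decode :: "code \<Rightarrow> nat \<Rightarrow> site \<Rightarrow> site \<times> site \<times> (nat \<times> site) set" where
  "decode Leaf t u = (u, u, {(t, u)})"
| "decode (Down a1 a2 a3 c) t u =
     (case decode c (t - 1) (u + a1) of (v, w, E) \<Rightarrow> (v - a2, w - a3, E))"
| "decode (Join k d c c') t u =
     (if k = 1 then
        case decode c' t u of (b, _, E') \<Rightarrow>
        case decode c t (b - d) of (v, w, E) \<Rightarrow> (v, w, E \<union> E')
      else case decode c t u of (v, w, E) \<Rightarrow>
        if k = 2 then case decode c' t (v + d) of (v', _, E') \<Rightarrow> (v', w, E \<union> E')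
        else case decode c' t (w + d) of (_, w', E') \<Rightarrow> (v, w', E \<union> E'))"

primrec leaves :: "code \<Rightarrow> nat" where
  "leaves Leaf = 1"
| "leaves (Down a1 a2 a3 c) = leaves c"
| "leaves (Join k d c c') = leaves c + leaves c'"

primrec downs :: "code \<Rightarrow> nat" where
  "downs Leaf = 0"
| "downs (Down a1 a2 a3 c) = Suc (downs c)"
| "downs (Join k d c c') = downs c + downs c'"

text \<open>Bounding the height makes the set of codes finite, so that weights can be summed by
  induction on \<open>h\<close>. The side conditions leave 2 * 2 * 2 = 8 kinds of
  \<open>Down\<close> and 3 * 6 = 18 kinds of \<open>Join\<close>.\<close>

primrec codes :: "nat \<Rightarrow> code set" where
  "codes 0 = {}"
| "codes (Suc h) =
     insert Leaf
       ({Down a1 a2 a3 c |a1 a2 a3 c. a1 \<in> A1 \<and> a2 \<in> A2 \<and> a3 \<in> A3 \<and> c \<in> codes h} \<union>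
        {Join k d c c' |k d c c'. k \<in> {1, 2, 3} \<and> d \<in> forks \<and> c \<in> codes h \<and> c' \<in> codes h})"

lemma leaves_pos: "0 < leaves c"
  by (induction c) auto

lemma codes_Suc_iff:
  "Leaf \<in> codes (Suc h)"
  "Down a1 a2 a3 c \<in> codes (Suc h) \<longleftrightarrow> a1 \<in> A1 \<and> a2 \<in> A2 \<and> a3 \<in> A3 \<and> c \<in> codes h"
  "Join k d c c' \<in> codes (Suc h) \<longleftrightarrow> k \<in> {1, 2, 3} \<and> d \<in> forks \<and> c \<in> codes h \<and> c' \<in> codes h"
  by auto

lemma codes_Suc_mono: "c \<in> codes h \<Longrightarrow> c \<in> codes (Suc h)"
proof (induction c arbitrary: h)
  case (Down a1 a2 a3 c)
  then show ?case by (cases h) (auto simp only: codes_Suc_iff codes.simps(1) empty_iff)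
next
  case (Join k d c c')
  then show ?case by (cases h) (auto simp only: codes_Suc_iff codes.simps(1) empty_iff)
qed simp

lemma codes_mono: "h \<le> h' \<Longrightarrow> codes h \<subseteq> codes h'"
  by (erule lift_Suc_mono_le[of codes, rotated]) (rule subsetI, erule codes_Suc_mono)

section \<open>Explained triples of poles and the three ways of gluing them\<close>

definition spread :: "site \<Rightarrow> site \<Rightarrow> site \<Rightarrow> int" where
  "spread u v w = fst w + snd w - fst u - snd v"

text \<open>The equation \<open>card E = leaves c\<close> forces the leaves to carry distinct
  errors, and \<open>F\<close> is the space-time region that contains them. With n leaves there are
  n - 1 gluings, each worth at most one unit of spread; hence the strict inequality.\<close>

definition explained ::
  "(nat \<times> site) set \<Rightarrow> nat \<Rightarrow> site \<Rightarrow> site \<Rightarrow> site \<Rightarrow> (nat \<times> site) set \<Rightarrow> bool" where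
  "explained Err t u v w F \<longleftrightarrow>
     (\<exists>h c E. c \<in> codes h \<and> decode c t u = (v, w, E) \<and> E \<subseteq> F \<inter> Err \<and>
        card E = leaves c \<and> spread u v w + int (downs c) < int (leaves c))"

lemma explained_mono: "explained Err t u v w F \<Longrightarrow> F \<subseteq> F' \<Longrightarrow> explained Err t u v w F'"
  unfolding explained_def by blast

lemma explained_Leaf:
  assumes "(t, u) \<in> Err" "(t, u) \<in> F"
  shows "explained Err t u u u F"
  unfolding explained_def
  using assms by (intro exI[of _ "Suc 0"] exI[of _ Leaf]) (simp add: spread_def)

text \<open>One step into the past raises both sides of the balance equally: the spread of the new
  poles is exactly one larger, which pays for the additional \<open>Down\<close>.\<close>

lemma explained_Down:
  assumes "explained Err t u' v' w' F" "u' - u \<in> A1" "v' - v \<in> A2" "w' - w \<in> A3"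
  shows "explained Err (Suc t) u v w F"
proof -
  obtain h c E where c: "c \<in> codes h" "decode c t u' = (v', w', E)" "E \<subseteq> F \<inter> Err"
    "card E = leaves c" "spread u' v' w' + int (downs c) < int (leaves c)"
    using assms(1) unfolding explained_def by blast
  have "spread u' v' w' = spread u v w + 1"
    using assms(2-4) by (cases u; cases v; cases w; cases u'; cases v'; cases w')
      (auto simp: spread_def A1_def A2_def A3_def)
  moreover have "decode (Down (u' - u) (v' - v) (w' - w) c) (Suc t) u = (v, w, E)"
    by (simp add: c(2))
  moreover have "Down (u' - u) (v' - v) (w' - w) c \<in> codes (Suc h)"
    unfolding codes_Suc_iff using c(1) assms(2-4) by blast
  ultimately show ?thesis
    unfolding explained_def using c(3-5)
    by (intro exI[of _ "Suc h"] exI[of _ "Down (u' - u) (v' - v) (w' - w) c"] exI[of _ E]) simp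
qed

text \<open>Disjoint regions keep the errors of the two trees distinct, so that their numbers add
  up.\<close>

lemma explained_Join:
  assumes cc': "c \<in> codes h" "c' \<in> codes h'" and k: "k \<in> {1, 2, 3}" "d \<in> forks"
    and dec: "decode (Join k d c c') t u = (v, w, E \<union> E')"
    and E: "E \<subseteq> F \<inter> Err" "card E = leaves c" and E': "E' \<subseteq> F' \<inter> Err" "card E' = leaves c'"
    and disj: "F \<inter> F' = {}"
    and size: "spread u v w + int (downs c) + int (downs c') < int (leaves c) + int (leaves c')"
  shows "explained Err t u v w (F \<union> F')"
proof -
  \<comment> \<open>An infinite set would have \<open>card\<close> 0, but every code has a
    leaf.\<close>
  have "finite E" "finite E'"
    using E E' leaves_pos[of c] leaves_pos[of c'] by (metis card.infinite less_irrefl)+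
  moreover have "E \<inter> E' = {}" using E E' disj by blast
  ultimately have "card (E \<union> E') = leaves (Join k d c c')"
    using E E' by (simp add: card_Un_disjoint)
  moreover have "Join k d c c' \<in> codes (Suc (max h h'))"
  proof -
    have "c \<in> codes (max h h')" "c' \<in> codes (max h h')"
      using cc' codes_mono[of h "max h h'"] codes_mono[of h' "max h h'"] by auto
    then show ?thesis using k unfolding codes_Suc_iff by blast
  qed
  moreover have "E \<union> E' \<subseteq> (F \<union> F') \<inter> Err"
    using E(1) E'(1) by blast
  moreover have "spread u v w + int (downs (Join k d c c')) < int (leaves (Join k d c c'))"
    using size by simp
  ultimately show ?thesis
    unfolding explained_def using dec by blast
qed

text \<open>The spread of \<open>u\<close>, \<open>a\<close>, \<open>a\<close> is
  \<open>fst a - fst u\<close>, so exchanging the pole \<open>b\<close> for \<open>u\<close> costs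
  at most the difference of the first coordinates of \<open>a\<close> and \<open>b\<close>, hence at
  most 1. Adding two strict integer inequalities leaves a slack of 1 that absorbs it. Since decoding
  starts at the first pole, the glued tree is read first here; the other two gluings use the second
  coordinate and the coordinate sum.\<close>

lemma explained_Join1:
  assumes "explained Err t b v w F" "explained Err t u a a F'" "a - b \<in> forks" "F \<inter> F' = {}"
  shows "explained Err t u v w (F \<union> F')"
proof -
  obtain h c E where c: "c \<in> codes h" "decode c t b = (v, w, E)" "E \<subseteq> F \<inter> Err"
    "card E = leaves c" "spread b v w + int (downs c) < int (leaves c)"
    using assms(1) unfolding explained_def by blast
  obtain h' c' E' where c': "c' \<in> codes h'" "decode c' t u = (a, a, E')" "E' \<subseteq> F' \<inter> Err"
    "card E' = leaves c'" "spread u a a + int (downs c') < int (leaves c')"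
    using assms(2) unfolding explained_def by blast
  have "spread u v w \<le> spread b v w + spread u a a + 1"
    using assms(3) by (cases a; cases b) (auto simp: spread_def forks_def)
  with c c' assms(3,4) show ?thesis
    by (intro explained_Join[of c h c' h' 1 "a - b" t u v w E E']) auto
qed

lemma explained_Join2:
  assumes "explained Err t u a w F" "explained Err t b v b F'" "b - a \<in> forks" "F \<inter> F' = {}"
  shows "explained Err t u v w (F \<union> F')"
proof -
  obtain h c E where c: "c \<in> codes h" "decode c t u = (a, w, E)" "E \<subseteq> F \<inter> Err"
    "card E = leaves c" "spread u a w + int (downs c) < int (leaves c)"
    using assms(1) unfolding explained_def by blast
  obtain h' c' E' where c': "c' \<in> codes h'" "decode c' t b = (v, b, E')" "E' \<subseteq> F' \<inter> Err"
    "card E' = leaves c'" "spread b v b + int (downs c') < int (leaves c')"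
    using assms(2) unfolding explained_def by blast
  have "spread u v w \<le> spread u a w + spread b v b + 1"
    using assms(3) by (cases a; cases b) (auto simp: spread_def forks_def)
  with c c' assms(3,4) show ?thesis
    by (intro explained_Join[of c h c' h' 2 "b - a" t u v w E E']) auto
qed

lemma explained_Join3:
  assumes "explained Err t u v a F" "explained Err t b b w F'" "b - a \<in> forks" "F \<inter> F' = {}"
  shows "explained Err t u v w (F \<union> F')"
proof -
  obtain h c E where c: "c \<in> codes h" "decode c t u = (v, a, E)" "E \<subseteq> F \<inter> Err"
    "card E = leaves c" "spread u v a + int (downs c) < int (leaves c)"
    using assms(1) unfolding explained_def by blast
  obtain h' c' E' where c': "c' \<in> codes h'" "decode c' t b = (b, w, E')" "E' \<subseteq> F' \<inter> Err"
    "card E' = leaves c'" "spread b b w + int (downs c') < int (leaves c')"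
    using assms(2) unfolding explained_def by blast
  have "spread u v w \<le> spread u v a + spread b b w + 1"
    using assms(3) by (cases a; cases b) (auto simp: spread_def forks_def)
  with c c' assms(3,4) show ?thesis
    by (intro explained_Join[of c h c' h' 3 "b - a" t u v w E E']) auto
qed

section \<open>Connected components of zeros and decomposition along classes\<close>

definition adjacency :: "(site \<times> site) set" where
  "adjacency = {(u, v). v - u \<in> forks}"

lemma sym_adjacency: "sym adjacency"
proof -
  have "- d \<in> forks" if "d \<in> forks" for d
    using that by (auto simp: forks_def)
  then show ?thesis unfolding sym_def adjacency_def
    by (simp only: mem_Collect_eq case_prod_conv) (metis minus_diff_eq)
qed

text \<open>Chains stay inside \<open>W\<close>, but the closure is reflexive everywhere; membership
  in \<open>W\<close> is therefore tracked separately.\<close>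

definition linked :: "(site \<times> site) set \<Rightarrow> site set \<Rightarrow> (site \<times> site) set" where
  "linked S W = ((S \<union> adjacency) \<inter> W \<times> W)\<^sup>*"

lemma linked_mono: "V \<subseteq> W \<Longrightarrow> linked S V \<subseteq> linked S W"
  unfolding linked_def by (intro rtrancl_mono) auto

lemma sym_linked: "sym S \<Longrightarrow> sym (linked S W)"
  unfolding linked_def using sym_adjacency by (intro sym_rtrancl) (simp add: sym_def, blast)

lemma linked_closed: "(u, v) \<in> linked S W \<Longrightarrow> u \<in> W \<Longrightarrow> v \<in> W"
  unfolding linked_def by (induction rule: rtrancl_induct) auto

text \<open>Follow the chain from \<open>u\<close> to its first entrance into the class of
  \<open>a\<close>. The entering step joins different classes, so it must be an adjacency, and
  everything before it avoids the class.\<close>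

lemma linked_entrance:
  assumes "equiv Y S" "W \<subseteq> Y" "(u, a) \<in> linked S W" "u \<in> W" "a \<in> W" "(u, a) \<notin> S"
  shows "\<exists>b\<in>W. \<exists>a'. (a, b) \<notin> S \<and> (a, a') \<in> S \<and> (b, a') \<in> adjacency \<and>
    (u, b) \<in> linked S (W - S `` {a})"
proof -
  have S: "sym S" "trans S" "\<And>x. x \<in> Y \<Longrightarrow> (x, x) \<in> S"
    using assms(1) by (auto simp: equiv_def refl_on_def)
  have "(u, a) \<in> ((S \<union> adjacency) \<inter> W \<times> W)\<^sup>*"
    using assms(3) by (simp add: linked_def)
  then have "(u, a) \<notin> S \<longrightarrow> (\<exists>b\<in>W. \<exists>a'. (a, b) \<notin> S \<and> (a, a') \<in> S \<and>
      (b, a') \<in> adjacency \<and> (u, b) \<in> linked S (W - S `` {a}))"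
  proof (induction rule: converse_rtrancl_induct)
    case base
    then show ?case using S(3)[of a] assms(2,5) by blast
  next
    case (step u x)
    show ?case
    proof (rule impI)
      assume ua: "(u, a) \<notin> S"
      then have au: "(a, u) \<notin> S" using S(1) by (auto dest: symD)
      show "\<exists>b\<in>W. \<exists>a'. (a, b) \<notin> S \<and> (a, a') \<in> S \<and>
        (b, a') \<in> adjacency \<and> (u, b) \<in> linked S (W - S `` {a})"
      proof (cases "(x, a) \<in> S")
        case True
        then have "(a, x) \<in> S" using S(1) by (auto dest: symD)
        moreover have "(u, x) \<notin> S" using True ua S(2) by (auto dest: transD)
        moreover have "(u, x) \<in> adjacency" "u \<in> W"
          using step.hyps(1) \<open>(u, x) \<notin> S\<close> by auto
        moreover have "(u, u) \<in> linked S (W - S `` {a})" by (simp add: linked_def)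
        ultimately show ?thesis using au by blast
      next
        case False
        then have ax: "(a, x) \<notin> S" using S(1) by (auto dest: symD)
        from False step.IH obtain b a' where b: "b \<in> W" "(a, b) \<notin> S" "(a, a') \<in> S"
          "(b, a') \<in> adjacency" "(x, b) \<in> linked S (W - S `` {a})"
          by blast
        have "(u, x) \<in> (S \<union> adjacency) \<inter> (W - S `` {a}) \<times> (W - S `` {a})"
          using step.hyps(1) au ax by auto
        then have "(u, b) \<in> linked S (W - S `` {a})"
          using b(5) unfolding linked_def by (rule converse_rtrancl_into_rtrancl)
        with b show ?thesis by blast
      qed
    qed
  qed
  then show ?thesis using assms(6) by simp
qed

text \<open>Remove the class of \<open>u\<close> and treat the components of the rest recursively: the other two poles
  lie in the class of \<open>u\<close>, in one common component, or in two components.\<close>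

lemma explained_linked:
  assumes S: "equiv Y S"
    and disj: "\<And>u v. u \<in> Y \<Longrightarrow> v \<in> Y \<Longrightarrow> R u \<inter> R v \<noteq> {} \<Longrightarrow> (u, v) \<in> S"
    and base: "\<And>u v w. (u, v) \<in> S \<Longrightarrow> (u, w) \<in> S \<Longrightarrow> explained Err t u v w (R u)"
    and W: "finite W" "W \<subseteq> Y" "S `` W \<subseteq> W"
    and uvw: "u \<in> W" "(u, v) \<in> linked S W" "(u, w) \<in> linked S W"
  shows "explained Err t u v w (\<Union>x\<in>linked S W `` {u}. R x)"
  using W uvw
proof (induction W arbitrary: u v w rule: finite_psubset_induct)
  case (psubset W)
  note W = psubset.prems(1-3) and v = psubset.prems(4) and w = psubset.prems(5)
  have eqS: "sym S" "trans S" "\<And>x. x \<in> Y \<Longrightarrow> (x, x) \<in> S"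
    using S by (auto simp: equiv_def refl_on_def)
  define V where "V = W - S `` {u}"
  have uY: "u \<in> Y" using W by auto
  have V: "V \<subset> W" "V \<subseteq> Y" "S `` V \<subseteq> V"
  proof -
    show "V \<subset> W" "V \<subseteq> Y" using W eqS(3)[OF uY] by (auto simp: V_def)
    show "S `` V \<subseteq> V"
    proof
      fix y assume "y \<in> S `` V"
      then obtain x where x: "x \<in> W" "(u, x) \<notin> S" "(x, y) \<in> S" by (auto simp: V_def)
      then have "(u, y) \<notin> S" using eqS(1,2) by (meson symD transD)
      then show "y \<in> V" using x W by (auto simp: V_def)
    qed
  qed
  have IH: "explained Err t u' v' w' (\<Union>x\<in>linked S V `` {u'}. R x)"
    if "u' \<in> V" "(u', v') \<in> linked S V" "(u', w') \<in> linked S V" for u' v' w'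
    using psubset.IH[OF V that] .
  have symV: "(x, y) \<in> linked S V \<Longrightarrow> (y, x) \<in> linked S V" for x y
    using sym_linked[OF eqS(1), of V] by (auto dest: symD)
  have transV: "(x, y) \<in> linked S V \<Longrightarrow> (y, z) \<in> linked S V \<Longrightarrow> (x, z) \<in> linked S V" for x y z
    unfolding linked_def by (rule rtrancl_trans)
  have reflV: "(x, x) \<in> linked S V" for x
    by (simp add: linked_def)
  have region_disj: "R x \<inter> R y = {}" if "x \<in> Y" "y \<in> Y" "(x, y) \<notin> S" for x y
    using disj that by blast
  have dV: "R u \<inter> (\<Union>x\<in>linked S V `` {b}. R x) = {}" if "b \<in> V" for b
  proof -
    have "R u \<inter> R x = {}" if "(b, x) \<in> linked S V" for x
      using linked_closed[OF that \<open>b \<in> V\<close>] V(2) uY by (intro region_disj) (auto simp: V_def)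
    then show ?thesis by blast
  qed
  \<comment> \<open>The chain is read backwards, from \<open>x\<close> to \<open>u\<close>, so that
    the class avoided before the entrance is the one removed in \<open>V\<close>.\<close>
  have entrance: "\<exists>b a. b \<in> V \<and> (u, a) \<in> S \<and> (b, a) \<in> adjacency \<and> (a, b) \<in> adjacency \<and>
      (x, b) \<in> linked S V \<and> (b, x) \<in> linked S V \<and> x \<in> V"
    if "(u, x) \<in> linked S W" "(u, x) \<notin> S" for x
  proof -
    have "(x, u) \<in> linked S W" "(x, u) \<notin> S" "x \<in> W"
      using that sym_linked[OF eqS(1), of W] eqS(1) linked_closed[OF that(1)] W
      by (auto dest: symD)
    then obtain b a where "b \<in> W" "(u, b) \<notin> S" "(u, a) \<in> S" "(b, a) \<in> adjacency"
        "(x, b) \<in> linked S V"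
      using linked_entrance[OF S W(1), of x u] W unfolding V_def by blast
    then show ?thesis
      using symV sym_adjacency that \<open>x \<in> W\<close> unfolding V_def by (blast dest: symD)
  qed
  have into: "R u \<subseteq> (\<Union>x\<in>linked S W `` {u}. R x)"
    unfolding linked_def by auto
  have intoV: "(\<Union>x\<in>linked S V `` {b}. R x) \<subseteq> (\<Union>x\<in>linked S W `` {u}. R x)"
    if "(u, y) \<in> linked S W" "(y, b) \<in> linked S V" for b y
  proof -
    have "(u, x) \<in> linked S W" if "(b, x) \<in> linked S V" for x
    proof -
      have "(y, x) \<in> linked S W"
        using transV[OF \<open>(y, b) \<in> linked S V\<close> that] linked_mono[of V W S] V(1) by blast
      then show ?thesis
        using \<open>(u, y) \<in> linked S W\<close> unfolding linked_def by (meson rtrancl_trans)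
    qed
    then show ?thesis by blast
  qed
  have uu: "(u, u) \<in> S" using eqS(3)[OF uY] .
  consider "(u, v) \<in> S" "(u, w) \<in> S" | "(u, v) \<notin> S" "(u, w) \<in> S" | "(u, v) \<in> S" "(u, w) \<notin> S"
    | "(u, v) \<notin> S" "(u, w) \<notin> S" by blast
  then show ?case
  proof cases
    case 1
    then show ?thesis using base explained_mono into by blast
  next
    case 2
    from entrance[OF v 2(1)] obtain b a where b: "b \<in> V" "(u, a) \<in> S" "(a, b) \<in> adjacency"
      "(v, b) \<in> linked S V" "(b, v) \<in> linked S V" by blast
    have "explained Err t u v w (R u \<union> (\<Union>x\<in>linked S V `` {b}. R x))"
      using explained_Join2[OF base[OF b(2) 2(2)] IH[OF b(1) b(5) reflV]] b(3) dV[OF b(1)]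
      by (simp add: adjacency_def)
    then show ?thesis by (rule explained_mono) (intro Un_least into intoV[OF v b(4)])
  next
    case 3
    from entrance[OF w 3(2)] obtain b a where b: "b \<in> V" "(u, a) \<in> S" "(a, b) \<in> adjacency"
      "(w, b) \<in> linked S V" "(b, w) \<in> linked S V" by blast
    have "explained Err t u v w (R u \<union> (\<Union>x\<in>linked S V `` {b}. R x))"
      using explained_Join3[OF base[OF 3(1) b(2)] IH[OF b(1) reflV b(5)]] b(3) dV[OF b(1)]
      by (simp add: adjacency_def)
    then show ?thesis by (rule explained_mono) (intro Un_least into intoV[OF w b(4)])
  next
    case 4
    from entrance[OF v 4(1)] obtain b a where b: "b \<in> V" "(u, a) \<in> S" "(b, a) \<in> adjacency"
      "(a, b) \<in> adjacency" "(v, b) \<in> linked S V" "(b, v) \<in> linked S V" "v \<in> V" by blast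
    from entrance[OF w 4(2)] obtain b' a' where b': "b' \<in> V" "(u, a') \<in> S"
      "(a', b') \<in> adjacency" "(w, b') \<in> linked S V" "(b', w) \<in> linked S V" by blast
    show ?thesis
    proof (cases "(b, w) \<in> linked S V")
      \<comment> \<open>One component contains both \<open>v\<close> and \<open>w\<close>: it
        explains \<open>b\<close>, \<open>v\<close>, \<open>w\<close>, and the class of
        \<open>u\<close> is glued to it at the first pole. A single gluing suffices, with the roles
        of class and component exchanged.\<close>
      case True
      have "explained Err t u v w ((\<Union>x\<in>linked S V `` {b}. R x) \<union> R u)"
        using explained_Join1[OF IH[OF b(1) b(6) True] base[OF b(2) b(2)]] b(3) dV[OF b(1)]
        by (simp add: adjacency_def Int_commute)
      then show ?thesis by (rule explained_mono) (intro Un_least into intoV[OF v b(5)])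
    next
      \<comment> \<open>The components of \<open>v\<close> and \<open>w\<close> differ, so their
        regions are disjoint and each is glued to the class of \<open>u\<close> separately.\<close>
      case False
      have "R x \<inter> R y = {}" if "(b, x) \<in> linked S V" "(b', y) \<in> linked S V" for x y
      proof (rule region_disj)
        show xy: "x \<in> Y" "y \<in> Y"
          using linked_closed[OF that(1) b(1)] linked_closed[OF that(2) b'(1)] V(2) by auto
        show "(x, y) \<notin> S"
        proof
          assume "(x, y) \<in> S"
          then have "(x, y) \<in> linked S V"
            using linked_closed[OF that(1) b(1)] linked_closed[OF that(2) b'(1)]
            unfolding linked_def by blast
          then show False using False that b'(5) symV transV by blast
        qed
      qed
      then have d: "(\<Union>x\<in>linked S V `` {b}. R x) \<inter> (\<Union>x\<in>linked S V `` {b'}. R x) = {}"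
        by blast
      have "explained Err t u v a' (R u \<union> (\<Union>x\<in>linked S V `` {b}. R x))"
        using explained_Join2[OF base[OF b(2) b'(2)] IH[OF b(1) b(6) reflV]] b(4) dV[OF b(1)]
        by (simp add: adjacency_def)
      from explained_Join3[OF this IH[OF b'(1) reflV b'(5)]] b'(3) dV[OF b'(1)] d
      have "explained Err t u v w
          (R u \<union> (\<Union>x\<in>linked S V `` {b}. R x) \<union> (\<Union>x\<in>linked S V `` {b'}. R x))"
        by (simp add: adjacency_def Int_Un_distrib2)
      then show ?thesis
        by (rule explained_mono) (intro Un_least into intoV[OF v b(5)] intoV[OF w b'(4)])
    qed
  qed
qed

section \<open>Pieces of the zero set and their pasts\<close>

text \<open>Level \<open>t\<close> holds the zeros at time \<open>t + 1\<close>, so that the error responsible for a zero carries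
  the same index; the sets are made finite by restricting to the backward cone of the origin.\<close>

locale zero_sets =
  fixes Z :: "nat \<Rightarrow> site set" and Err :: "(nat \<times> site) set"
  assumes finite_Z: "finite (Z t)"
    and Z_0: "u \<in> Z 0 \<Longrightarrow> (0, u) \<in> Err"
    and pred1: "u \<in> Z (Suc t) \<Longrightarrow> (Suc t, u) \<notin> Err \<Longrightarrow> \<exists>v\<in>Z t. v - u \<in> A1"
    and pred2: "u \<in> Z (Suc t) \<Longrightarrow> (Suc t, u) \<notin> Err \<Longrightarrow> \<exists>v\<in>Z t. v - u \<in> A2"
    and pred3: "u \<in> Z (Suc t) \<Longrightarrow> (Suc t, u) \<notin> Err \<Longrightarrow> \<exists>v\<in>Z t. v - u \<in> A3"
begin

definition below :: "nat \<Rightarrow> site \<Rightarrow> site set" where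
  "below t u = {v \<in> Z t. v - u \<in> A1 \<union> A2 \<union> A3}"

text \<open>Non-errors belong to the same piece if their predecessors are connected in the past;
  \<open>region\<close> is the past of a piece, and distinct pieces have disjoint regions.\<close>

primrec piece :: "nat \<Rightarrow> (site \<times> site) set" where
  "piece 0 = {(u, v). u \<in> Z 0 \<and> u = v}"
| "piece (Suc t) = {(u, v). u \<in> Z (Suc t) \<and> v \<in> Z (Suc t) \<and>
     (if (Suc t, u) \<in> Err \<or> (Suc t, v) \<in> Err then u = v
      else \<exists>u'\<in>below t u. \<exists>v'\<in>below t v. (u', v') \<in> linked (piece t) (Z t))}"

primrec region :: "nat \<Rightarrow> site \<Rightarrow> (nat \<times> site) set" where
  "region 0 u = {(0, u)}"
| "region (Suc t) u = (if (Suc t, u) \<in> Err then {(Suc t, u)}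
     else \<Union>u'\<in>below t u. \<Union>x\<in>linked (piece t) (Z t) `` {u'}. region t x)"

text \<open>Predecessors of one site are mutual neighbours, by the choice of
  \<open>forks\<close>.\<close>

lemma below_linked:
  assumes "v \<in> below t u" "w \<in> below t u"
  shows "(v, w) \<in> linked S (Z t)"
proof (cases "v = w")
  case True
  then show ?thesis by (simp add: linked_def)
next
  case False
  have "w - u \<noteq> v - u" using False by simp
  moreover have "a - b \<in> forks" if "a \<in> A1 \<union> A2 \<union> A3" "b \<in> A1 \<union> A2 \<union> A3" "a \<noteq> b" for a b
    using that by (auto simp: A1_def A2_def A3_def forks_def)
  ultimately have "(w - u) - (v - u) \<in> forks" using assms unfolding below_def by blast
  then have "w - v \<in> forks" by simp
  then show ?thesis
    using assms unfolding linked_def by (intro r_into_rtrancl) (simp add: below_def adjacency_def)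
qed

text \<open>Reflexivity at a non-error needs some predecessor in \<open>Z t\<close>. For
  transitivity, the two chains may end at different predecessors of the middle site, but these are
  linked by \<open>below_linked\<close>.\<close>

lemma equiv_piece: "equiv (Z t) (piece t)"
proof (induction t)
  case 0
  show ?case by (intro equivI refl_onI symI transI) auto
next
  case (Suc t)
  have symL: "(x, y) \<in> linked (piece t) (Z t) \<Longrightarrow> (y, x) \<in> linked (piece t) (Z t)" for x y
    using sym_linked[of "piece t" "Z t"] Suc by (auto simp: equiv_def dest: symD)
  have transL: "(x, y) \<in> linked (piece t) (Z t) \<Longrightarrow> (y, z) \<in> linked (piece t) (Z t) \<Longrightarrow>
      (x, z) \<in> linked (piece t) (Z t)" for x y z
    unfolding linked_def by (rule rtrancl_trans)
  show ?case
  proof (intro equivI refl_onI symI transI)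
    show "piece (Suc t) \<subseteq> Z (Suc t) \<times> Z (Suc t)" by auto
  next
    fix u assume u: "u \<in> Z (Suc t)"
    have "\<exists>u'. u' \<in> below t u" if "(Suc t, u) \<notin> Err"
      using pred1[OF u that] unfolding below_def by blast
    then show "(u, u) \<in> piece (Suc t)"
      using u by (auto simp: linked_def)
  next
    fix u v assume "(u, v) \<in> piece (Suc t)"
    then show "(v, u) \<in> piece (Suc t)"
      using symL by (simp split: if_splits) blast+
  next
    fix u v w assume uv: "(u, v) \<in> piece (Suc t)" and vw: "(v, w) \<in> piece (Suc t)"
    show "(u, w) \<in> piece (Suc t)"
    proof (cases "u = v \<or> v = w")
      case True
      then show ?thesis using uv vw by blast
    next
      case False
      then have e: "(Suc t, u) \<notin> Err" "(Suc t, v) \<notin> Err" "(Suc t, w) \<notin> Err"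
        and Z: "u \<in> Z (Suc t)" "w \<in> Z (Suc t)"
        using uv vw by (simp_all split: if_splits)
      from e uv obtain u' v' where 1: "u' \<in> below t u" "v' \<in> below t v"
        "(u', v') \<in> linked (piece t) (Z t)" by auto
      from e vw obtain v'' w' where 2: "v'' \<in> below t v" "w' \<in> below t w"
        "(v'', w') \<in> linked (piece t) (Z t)" by auto
      have "(u', w') \<in> linked (piece t) (Z t)"
        using transL[OF transL[OF 1(3) below_linked[OF 1(2) 2(1)]] 2(3)] .
      then show ?thesis using 1(1) 2(2) e Z by auto
    qed
  qed
qed

lemma region_time: "(s, x) \<in> region t u \<Longrightarrow> s \<le> t"
  by (induction t arbitrary: u) (auto split: if_splits simp: le_SucI)

lemma region_top: "(Suc t, x) \<in> region (Suc t) u \<Longrightarrow> x = u"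
  by (auto split: if_splits dest: region_time)

text \<open>Induction on the level: a common point of the pasts of two non-errors lies, one level
  down, in the regions of two sites of the same piece, and this links the predecessors.\<close>

lemma region_overlap:
  assumes "u \<in> Z t" "v \<in> Z t" "region t u \<inter> region t v \<noteq> {}"
  shows "(u, v) \<in> piece t"
  using assms
proof (induction t arbitrary: u v)
  case (Suc t)
  from Suc.prems(3) obtain s x where q: "(s, x) \<in> region (Suc t) u" "(s, x) \<in> region (Suc t) v"
    by auto
  show ?case
  proof (cases "(Suc t, u) \<in> Err \<or> (Suc t, v) \<in> Err")
    case True
    \<comment> \<open>The region of an error is a single point at the top level, and a region
      contains no other top-level point than its own site.\<close>
    then have "s = Suc t" using q by (auto split: if_splits)
    then have "u = v" using q region_top by blast
    then show ?thesis using Suc.prems equiv_piece[of "Suc t"] by (auto simp: equiv_def dest: refl_onD)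
  next
    case False
    then have "(s, x) \<in> (\<Union>u'\<in>below t u. \<Union>y\<in>linked (piece t) (Z t) `` {u'}. region t y)"
      "(s, x) \<in> (\<Union>v'\<in>below t v. \<Union>z\<in>linked (piece t) (Z t) `` {v'}. region t z)"
      using q by simp_all
    then obtain u' v' y z where *: "u' \<in> below t u" "v' \<in> below t v"
      "(u', y) \<in> linked (piece t) (Z t)" "(v', z) \<in> linked (piece t) (Z t)"
      "(s, x) \<in> region t y" "(s, x) \<in> region t z"
      by blast
    have yz: "y \<in> Z t" "z \<in> Z t"
      using linked_closed[OF *(3)] linked_closed[OF *(4)] *(1,2) by (auto simp: below_def)
    then have "(y, z) \<in> piece t" using Suc.IH *(5,6) by blast
    then have "(y, z) \<in> linked (piece t) (Z t)" using yz unfolding linked_def by blast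
    moreover have "(z, v') \<in> linked (piece t) (Z t)"
      using *(4) sym_linked[of "piece t" "Z t"] equiv_piece[of t] by (auto simp: equiv_def dest: symD)
    ultimately have "(u', v') \<in> linked (piece t) (Z t)"
      using *(3) unfolding linked_def by (meson rtrancl_trans)
    then show ?thesis using False Suc.prems *(1,2) by auto
  qed
qed auto

text \<open>At a non-error the poles step back inside \<open>A1\<close>, \<open>A2\<close>,
  \<open>A3\<close>. The new poles are linked at level \<open>t\<close>, where the induction
  hypothesis explains the pieces and \<open>explained_linked\<close> assembles them.\<close>

lemma explained_piece:
  "(u, v) \<in> piece t \<Longrightarrow> (u, w) \<in> piece t \<Longrightarrow> explained Err t u v w (region t u)"
proof (induction t arbitrary: u v w)
  case 0
  then have "v = u" "w = u" "u \<in> Z 0" by auto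
  then show ?case using explained_Leaf Z_0 by simp
next
  case (Suc t)
  have Z: "u \<in> Z (Suc t)" "v \<in> Z (Suc t)" "w \<in> Z (Suc t)" using Suc.prems by auto
  show ?case
  proof (cases "(Suc t, u) \<in> Err")
    case True
    then have "v = u" "w = u" using Suc.prems by auto
    then show ?thesis using explained_Leaf[OF True] True by simp
  next
    case False
    then have e: "(Suc t, v) \<notin> Err" "(Suc t, w) \<notin> Err"
      using Suc.prems by (auto split: if_splits)
    obtain u' v' w' where u': "u' \<in> Z t" "u' - u \<in> A1" and v': "v' \<in> Z t" "v' - v \<in> A2"
      and w': "w' \<in> Z t" "w' - w \<in> A3"
      using pred1[OF Z(1) False] pred2[OF Z(2) e(1)] pred3[OF Z(3) e(2)] by blast
    have b: "u' \<in> below t u" "v' \<in> below t v" "w' \<in> below t w"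
      using u' v' w' by (auto simp: below_def)
    have link: "(u', y') \<in> linked (piece t) (Z t)"
      if y: "(u, y) \<in> piece (Suc t)" "(Suc t, y) \<notin> Err" "y' \<in> below t y" for y y'
    proof -
      from y False obtain x x' where x: "x \<in> below t u" "x' \<in> below t y"
        "(x, x') \<in> linked (piece t) (Z t)" by auto
      from below_linked[OF b(1) x(1)] x(3) below_linked[OF x(2) y(3)] show ?thesis
        unfolding linked_def by (meson rtrancl_trans)
    qed
    have "explained Err t u' v' w' (\<Union>x\<in>linked (piece t) (Z t) `` {u'}. region t x)"
    proof (rule explained_linked[OF equiv_piece[of t] region_overlap Suc.IH finite_Z])
      show "piece t `` Z t \<subseteq> Z t" using equiv_piece[of t] by (auto simp: equiv_def)
      show "(u', v') \<in> linked (piece t) (Z t)" "(u', w') \<in> linked (piece t) (Z t)"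
        using link Suc.prems e b by blast+
    qed (use u' in auto)
    then have "explained Err t u' v' w' (region (Suc t) u)"
      by (rule explained_mono) (use b(1) False in auto)
    then show ?thesis using explained_Down u'(2) v'(2) w'(2) by blast
  qed
qed

lemma explained_zero: "u \<in> Z t \<Longrightarrow> explained Err t u u u UNIV"
  using explained_piece[of u u t u] equiv_piece[of t]
  by (auto simp: equiv_def dest: refl_onD intro: explained_mono)

end

section \<open>From a zero of the automaton to a code\<close>

definition errors_of :: "code \<Rightarrow> nat \<Rightarrow> (nat \<times> site) set" where
  "errors_of c t = snd (snd (decode c t (0, 0)))"

lemma perturbed_ca_explained:
  assumes "\<not> perturbed_ca nec_majority \<xi> (Suc t) (0, 0)"
  shows "\<exists>h. \<exists>c\<in>codes h. card (errors_of c t) = leaves c \<and> downs c < leaves c \<and>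
    (\<forall>e\<in>errors_of c t. \<xi> e)"
proof -
  \<comment> \<open>The shift by one discards the all-one initial state: at level 0 the zeros are
    exactly the errors.\<close>
  define X where "X s = perturbed_ca nec_majority \<xi> (Suc s)" for s
  have X_0: "X 0 u \<longleftrightarrow> \<not> \<xi> (0, u)" for u
    by (simp add: X_def nec_majority_def)
  have X_Suc: "X (Suc s) u \<longleftrightarrow> \<not> \<xi> (Suc s, u) \<and> nec_majority (\<lambda>j. X s (j + u))" for s u
    by (simp add: X_def)
  \<comment> \<open>The triangle is closed under predecessors: going one level down, the coordinate
    sum grows by at most 1 while \<open>s\<close> drops by 1.\<close>
  define Z where
    "Z s = {i. 0 \<le> fst i \<and> 0 \<le> snd i \<and> fst i + snd i + int s \<le> int t \<and> \<not> X s i}" for s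
  have preds: "(\<exists>v\<in>Z s. v - u \<in> A1) \<and> (\<exists>v\<in>Z s. v - u \<in> A2) \<and> (\<exists>v\<in>Z s. v - u \<in> A3)"
    if u: "u \<in> Z (Suc s)" "\<not> \<xi> (Suc s, u)" for u s
  proof -
    have "\<not> nec_majority (\<lambda>j. X s (j + u))" using u by (simp add: Z_def X_Suc)
    then have "\<not> X s ((0, 0) + u) \<and> \<not> X s ((1, 0) + u) \<or>
        \<not> X s ((0, 0) + u) \<and> \<not> X s ((0, 1) + u) \<or> \<not> X s ((1, 0) + u) \<and> \<not> X s ((0, 1) + u)"
      unfolding nec_majority_def
      by (cases "X s ((0, 0) + u)"; cases "X s ((1, 0) + u)"; cases "X s ((0, 1) + u)") simp_all
    moreover have "\<exists>v\<in>Z s. v - u \<in> A"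
      if "\<not> X s (d + u)" "d \<in> {(0, 0), (1, 0), (0, 1)}" "d \<in> A" for d A
    proof
      show "d + u \<in> Z s" using u(1) that(1,2) by (auto simp: Z_def)
      show "d + u - u \<in> A" using that(3) by simp
    qed
    \<comment> \<open>Two of the three predecessors are zeros, and any two of them meet each of the
      three pairs.\<close>
    ultimately show ?thesis unfolding A1_def A2_def A3_def by (metis insertI1 insertI2)
  qed
  interpret zero_sets Z "{e. \<xi> e}"
  proof
    fix s
    have "Z s \<subseteq> {0..int t} \<times> {0..int t}" by (auto simp: Z_def)
    then show "finite (Z s)" by (rule finite_subset) simp
  next
    fix u assume "u \<in> Z 0"
    then show "(0, u) \<in> {e. \<xi> e}" by (simp add: Z_def X_0)
  qed (use preds in auto)
  have "(0, 0) \<in> Z t" using assms by (simp add: Z_def X_def)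
  then have "explained {e. \<xi> e} t (0, 0) (0, 0) (0, 0) UNIV" by (rule explained_zero)
  then obtain h c E where c: "c \<in> codes h" "decode c t (0, 0) = ((0, 0), (0, 0), E)"
    "E \<subseteq> {e. \<xi> e}" "card E = leaves c" "downs c < leaves c"
    unfolding explained_def by (auto simp: spread_def)
  then have "errors_of c t = E" by (simp add: errors_of_def)
  with c show ?thesis by blast
qed

section \<open>Weights and the counting of trees\<close>

primrec weight :: "code \<Rightarrow> real" where
  "weight Leaf = 1"
| "weight (Down a1 a2 a3 c) = weight c / 24"
| "weight (Join k d c c') = weight c * weight c' / 162"

lemma weight_nonneg: "0 \<le> weight c"
  by (induction c) auto

lemma weight_eq: "weight c = (1 / 162) ^ (leaves c - 1) * (1 / 24) ^ downs c"
proof (induction c)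
  case (Join k d c c')
  have "leaves c + leaves c' - 1 = Suc ((leaves c - 1) + (leaves c' - 1))"
    using leaves_pos[of c] leaves_pos[of c'] by linarith
  then have "(1 / 162 :: real) ^ (leaves c + leaves c' - 1) =
      1 / 162 * ((1 / 162) ^ (leaves c - 1) * (1 / 162) ^ (leaves c' - 1))"
    by (simp only: power_Suc power_add)
  then show ?case
    by (simp only: weight.simps leaves.simps downs.simps Join power_add) simp
qed auto

text \<open>With n leaves there are n - 1 gluings and at most n - 1 backward steps, so spreading the
  error probability 1/3888 = 1/162 * 1/24 over them leaves one factor 1/3888.\<close>

lemma power_leaves_le_weight:
  assumes "downs c < leaves c"
  shows "(1 / 3888 :: real) ^ leaves c \<le> weight c / 3888"
proof -
  obtain n where n: "leaves c = Suc n" using assms by (cases "leaves c") auto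
  have "(1 / 3888 :: real) ^ n = (1 / 162 * (1 / 24)) ^ n" by simp
  also have "\<dots> = (1 / 162) ^ n * (1 / 24) ^ n" by (rule power_mult_distrib)
  also have "\<dots> \<le> (1 / 162) ^ n * (1 / 24) ^ downs c"
    using assms n by (intro mult_left_mono power_decreasing) auto
  finally show ?thesis by (simp add: n weight_eq)
qed

lemma codes_Suc_subset:
  "codes (Suc h) \<subseteq> insert Leaf
     ((\<lambda>(a1, a2, a3, c). Down a1 a2 a3 c) ` (A1 \<times> A2 \<times> A3 \<times> codes h) \<union>
      (\<lambda>(k, d, c, c'). Join k d c c') ` ({1, 2, 3} \<times> forks \<times> codes h \<times> codes h))"
    (is "_ \<subseteq> insert _ (?d ` ?D \<union> ?j ` ?J)")
proof
  fix x assume x: "x \<in> codes (Suc h)"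
  show "x \<in> insert Leaf (?d ` ?D \<union> ?j ` ?J)"
  proof (cases x)
    case Leaf
    then show ?thesis by simp
  next
    case (Down a1 a2 a3 c)
    then have "(a1, a2, a3, c) \<in> ?D" using x unfolding Down codes_Suc_iff by blast
    then have "?d (a1, a2, a3, c) \<in> ?d ` ?D" by (rule imageI)
    then show ?thesis unfolding Down by simp
  next
    case (Join k d c c')
    then have "(k, d, c, c') \<in> ?J" using x unfolding Join codes_Suc_iff by blast
    then have "?j (k, d, c, c') \<in> ?j ` ?J" by (rule imageI)
    then show ?thesis unfolding Join by simp
  qed
qed

lemma finite_offsets: "finite A1" "finite A2" "finite A3" "finite forks"
  by (simp_all add: A1_def A2_def A3_def forks_def)

lemma finite_codes: "finite (codes h)"
proof (induction h)
  case (Suc h)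
  then show ?case by (intro finite_subset[OF codes_Suc_subset]) (simp add: finite_offsets)
qed simp

text \<open>The bound 3 reproduces itself: 1 + (8/24) * 3 + (18/162) * 9 = 3. In fact 3 is a double
  root of C = 1 + C/3 + C^2/9. A real root of C = 1 + 8yC + 18xC^2 below the singularity 8y = 1
  requires 72x <= (1 - 8y)^2, and under this constraint xy is largest at the chosen values.\<close>

lemma sum_weight_le: "sum weight (codes h) \<le> 3"
proof (induction h)
  case (Suc h)
  let ?C = "sum weight (codes h)"
  let ?D = "A1 \<times> A2 \<times> A3 \<times> codes h"
  let ?J = "{1, 2, 3 :: nat} \<times> forks \<times> codes h \<times> codes h"
  let ?d = "\<lambda>(a1, a2, a3, c). Down a1 a2 a3 c" and ?j = "\<lambda>(k, d, c, c'). Join k d c c'"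
  have fin: "finite ?D" "finite ?J" by (simp_all add: finite_offsets finite_codes)
  have card: "card A1 = 2" "card A2 = 2" "card A3 = 2" "card forks = 6"
    by (simp_all add: A1_def A2_def A3_def forks_def)
  have C0: "0 \<le> ?C" by (intro sum_nonneg weight_nonneg)
  have "sum weight (?d ` ?D) = (\<Sum>x\<in>?D. weight (?d x))"
    by (rule sum.reindex_cong[OF _ refl refl], rule inj_onI) (simp add: case_prod_unfold prod_eq_iff)
  also have "\<dots> = (\<Sum>a1\<in>A1. \<Sum>a2\<in>A2. \<Sum>a3\<in>A3. \<Sum>c\<in>codes h. weight c / 24)"
    by (simp only: sum.cartesian_product case_prod_unfold weight.simps)
  also have "\<dots> = ?C / 3" by (simp add: card sum_divide_distrib[symmetric])
  finally have D: "sum weight (?d ` ?D) = ?C / 3" .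
  have "sum weight (?j ` ?J) = (\<Sum>x\<in>?J. weight (?j x))"
    by (rule sum.reindex_cong[OF _ refl refl], rule inj_onI) (simp add: case_prod_unfold prod_eq_iff)
  also have "\<dots> = (\<Sum>k\<in>{1, 2, 3 :: nat}. \<Sum>d\<in>forks. \<Sum>c\<in>codes h. \<Sum>c'\<in>codes h. weight c * weight c' / 162)"
    by (simp only: sum.cartesian_product case_prod_unfold weight.simps)
  also have "\<dots> = (\<Sum>k\<in>{1, 2, 3 :: nat}. \<Sum>d\<in>forks. ?C * ?C / 162)"
    by (simp only: sum_product sum_divide_distrib)
  also have "\<dots> = ?C * ?C / 9" by (simp add: card)
  finally have J: "sum weight (?j ` ?J) = ?C * ?C / 9" .
  have "sum weight (codes (Suc h)) \<le> sum weight (insert Leaf (?d ` ?D \<union> ?j ` ?J))"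
    using fin by (intro sum_mono2 codes_Suc_subset weight_nonneg) simp
  also have "\<dots> = weight Leaf + sum weight (?d ` ?D \<union> ?j ` ?J)"
    using fin by (intro sum.insert) auto
  also have "sum weight (?d ` ?D \<union> ?j ` ?J) = sum weight (?d ` ?D) + sum weight (?j ` ?J)"
    using fin by (intro sum.union_disjoint) auto
  finally have "sum weight (codes (Suc h)) \<le> 1 + (?C / 3 + ?C * ?C / 9)"
    unfolding D J by simp
  moreover have "?C * ?C \<le> 3 * 3" using Suc C0 by (intro mult_mono) auto
  ultimately show ?case using Suc by simp
qed simp

section \<open>Union bound and the stability threshold\<close>

lemma measure_noise_cylinder:
  assumes "0 \<le> p" "p \<le> 1" "finite E"
  shows "measure (noise p) {\<xi> \<in> space (noise p). \<forall>e\<in>E. \<xi> e} = p ^ card E"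
proof -
  interpret product_prob_space "\<lambda>_. measure_pmf (bernoulli_pmf p)" "UNIV :: (nat \<times> site) set"
    by standard
  \<comment> \<open>Membership in \<open>{True}\<close> gives the event the shape of a product
    cylinder.\<close>
  have "emeasure (noise p) {\<xi> \<in> space (noise p). \<forall>e\<in>E. \<xi> e \<in> {True}} = ennreal (p ^ card E)"
    unfolding noise_def using assms
    by (subst emeasure_PiM_Collect) (simp_all add: emeasure_pmf_single ennreal_power)
  then show ?thesis using assms by (simp add: measure_def)
qed

text \<open>A union bound over the codes of height at most \<open>h\<close> gives 3 * (1/3888) =
  1/1296, uniformly in \<open>h\<close> and in the time.\<close>

lemma prob_zero_le:
  "measure (noise (1 / 3888)) {\<xi> \<in> space (noise (1 / 3888)).
     \<not> perturbed_ca nec_majority \<xi> (Suc t) (0, 0)} \<le> 1 / 1296"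
proof -
  let ?M = "noise (1 / 3888)"
  interpret prob_space ?M by (rule prob_space_noise)
  define G where "G h = {c \<in> codes h. card (errors_of c t) = leaves c \<and> downs c < leaves c}" for h
  define A where "A c = {\<xi> \<in> space ?M. \<forall>e\<in>errors_of c t. \<xi> e}" for c
  define B where "B h = (\<Union>c\<in>G h. A c)" for h
  have finE: "finite (errors_of c t)" if "c \<in> G h" for c h
    using that leaves_pos[of c] unfolding G_def by (metis (mono_tags, lifting) card.infinite less_irrefl mem_Collect_eq)
  have finG: "finite (G h)" for h unfolding G_def using finite_codes by simp
  have [measurable]: "Measurable.pred ?M (\<lambda>\<xi>. \<xi> e)" for e
    unfolding noise_def by (rule measurable_compose[OF measurable_component_singleton]) auto
  have A: "A c \<in> events" if "c \<in> G h" for c h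
    unfolding A_def using finE[OF that] by measurable
  have B: "B h \<in> events" for h unfolding B_def using A finG by (intro sets.finite_UN) auto
  have le: "prob (B h) \<le> 1 / 1296" for h
  proof -
    have "prob (B h) \<le> (\<Sum>c\<in>G h. prob (A c))"
      unfolding B_def using A finG by (intro finite_measure_subadditive_finite) auto
    also have "\<dots> = (\<Sum>c\<in>G h. (1 / 3888) ^ leaves c)"
      using finE by (intro sum.cong) (auto simp: A_def measure_noise_cylinder G_def)
    also have "\<dots> \<le> (\<Sum>c\<in>G h. weight c / 3888)"
      by (intro sum_mono power_leaves_le_weight) (simp add: G_def)
    also have "\<dots> \<le> (\<Sum>c\<in>codes h. weight c / 3888)"
      using finite_codes weight_nonneg by (intro sum_mono2) (auto simp: G_def)
    also have "\<dots> \<le> 3 / 3888"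
      using sum_weight_le[of h] by (simp add: sum_divide_distrib[symmetric])
    finally show ?thesis by simp
  qed
  \<comment> \<open>The code explaining a zero comes with no prescribed height; continuity from
    below passes the uniform bound to all heights.\<close>
  have "incseq B"
    unfolding incseq_def B_def G_def using codes_mono by (intro allI impI UN_mono) blast+
  then have "(\<lambda>h. prob (B h)) \<longlonglongrightarrow> prob (\<Union>h. B h)"
    using B by (intro finite_Lim_measure_incseq) auto
  then have "prob (\<Union>h. B h) \<le> 1 / 1296"
    by (rule LIMSEQ_le_const2) (use le in auto)
  moreover have "{\<xi> \<in> space ?M. \<not> perturbed_ca nec_majority \<xi> (Suc t) (0, 0)} \<subseteq> (\<Union>h. B h)"
  proof
    fix \<xi> assume \<xi>: "\<xi> \<in> {\<xi> \<in> space ?M. \<not> perturbed_ca nec_majority \<xi> (Suc t) (0, 0)}"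
    then obtain h c where "c \<in> G h" "\<forall>e\<in>errors_of c t. \<xi> e"
      using perturbed_ca_explained[of \<xi> t] unfolding G_def by blast
    then show "\<xi> \<in> (\<Union>h. B h)" using \<xi> unfolding B_def A_def by blast
  qed
  then have "prob {\<xi> \<in> space ?M. \<not> perturbed_ca nec_majority \<xi> (Suc t) (0, 0)} \<le> prob (\<Union>h. B h)"
    using B by (intro finite_measure_mono) auto
  ultimately show ?thesis by simp
qed

lemma prob_one_at_origin_ge: "1295 / 1296 \<le> prob_one_at_origin nec_majority (1 / 3888) t"
proof (cases t)
  case 0
  interpret prob_space "noise (1 / 3888)" by (rule prob_space_noise)
  show ?thesis using 0 by (simp add: prob_one_at_origin_def prob_space)
next
  case (Suc s)
  let ?M = "noise (1 / 3888)"
  interpret prob_space ?M by (rule prob_space_noise)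
  have "prob {\<xi> \<in> space ?M. \<not> perturbed_ca nec_majority \<xi> t (0, 0)} =
      1 - prob {\<xi> \<in> space ?M. perturbed_ca nec_majority \<xi> t (0, 0)}"
    using measurable_perturbed_ca[OF depends_on_finitely_many_nec_majority]
    by (rule prob_neg)
  then show ?thesis using prob_zero_le[of s] Suc by (simp add: prob_one_at_origin_def del: perturbed_ca.simps)
qed

text \<open>The value 1/3888 itself belongs to the set whose supremum is taken, and that set is
  bounded by 1. As 1/3888 exceeds 2.5 * 10^(-4), it lies far above the constant to be
  beaten.\<close>

lemma stability_threshold_nec_ge: "1 / 3888 \<le> stability_threshold nec_majority"
proof -
  have "ereal (1295 / 1296) \<le> liminf (\<lambda>t. ereal (prob_one_at_origin nec_majority (1 / 3888) t))"
    by (intro Liminf_bounded always_eventually allI) (simp only: ereal_less_eq prob_one_at_origin_ge)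
  moreover have "(0 :: ereal) < ereal (1295 / 1296)" by simp
  ultimately have "0 < liminf (\<lambda>t. ereal (prob_one_at_origin nec_majority (1 / 3888) t))"
    by (rule less_le_trans[rotated])
  then show ?thesis
    unfolding stability_threshold_def by (intro cSup_upper bdd_aboveI[of _ 1]) auto
qed

theorem theorem1p4: "2.8 / 10 ^ 6 < stability_threshold nec_majority"
  using stability_threshold_nec_ge by (rule less_le_trans[rotated]) simp

end
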